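(* Let $V$ be a simple vertex operator algebra and let $G$ be a finite group of automorphisms of $V$ (acting faithfully). Assume that $G$ is either abelian or dihedral. Then the map $H\mapsto V^H$ is a bijection from the set of subgroups $H$ of $G$ to the set of sub vertex operator algebras $W$ of $V$ with $V^G\subseteq W$.
   Context: A vertex operator algebra (VOA) $V=\coprod_{n\in\mathbb Z}V_n$ has vertex operators $Y(v,z)=\sum_{n\in\mathbb Z}v_nz^{-n-1}$, vacuum $\mathbf 1$ and Virasoro element $\omega$. $V$ is simple if the only subspaces of $V$ invariant under all $v_n$ ($v\in V$, $n\in\mathbb Z$) are $0$ and $V$. An automorphism of $V$ is an invertible linear map $g:V\to V$ with $gY(v,z)g^{-1}=Y(gv,z)$ for all $v\in V$, $g\mathbf 1=\mathbf 1$, $g\omega=\omega$. For a group $H$ of automorphisms, $V^H=\{v\in V: hv=v \ \forall h\in H\}$ is the subspace of $H$-invariants; it is a sub VOA. A sub VOA of $V$ is a graded subspace containing $\mathbf 1$ and $\omega$ and closed under all operations $u_n$, $u$ in the subspace, $n\in\mathbb Z$. *)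

theory Defs
  imports Complex_Main
begin

text \<open>
  A vertex operator algebra over the complex numbers.  The underlying vector space
  is the whole type 'v (an abelian group) with scalar multiplication sc.
  Y u n v denotes the mode u_n applied to v, i.e. Y(u,z) = sum_n u_n z^(-n-1).
  vac is the vacuum, om the Virasoro element, Vn k the homogeneous subspace V_k.
  Axioms follow Lepowsky--Li (Definition 3.1.22), with the Jacobi identity in its
  equivalent component (Borcherds) form.  All infinite sums there have finite support
  by the truncation axiom, so they are written as sums over their support.
\<close>

definition fsum :: "(int \<Rightarrow> 'v::ab_group_add) \<Rightarrow> 'v" where
  "fsum f = (\<Sum>i\<in>{i. i \<ge> 0 \<and> f i \<noteq> 0}. f i)"

definition is_VOA ::
  "(complex \<Rightarrow> 'v::ab_group_add \<Rightarrow> 'v) \<Rightarrow> ('v \<Rightarrow> int \<Rightarrow> 'v \<Rightarrow> 'v) \<Rightarrow> 'v \<Rightarrow> 'v \<Rightarrow> (int \<Rightarrow> 'v set) \<Rightarrow> bool"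
where
  "is_VOA sc Y vac om Vn \<longleftrightarrow>
     vector_space sc
   \<comment> \<open>grading: V = direct sum of the V_n, dim V_n finite, V_n = 0 for n small\<close>
   \<and> (\<forall>k. module.subspace sc (Vn k))
   \<and> module.span sc (\<Union>k. Vn k) = UNIV
   \<and> (\<forall>S f. finite S \<longrightarrow> (\<forall>k\<in>S. f k \<in> Vn k) \<longrightarrow> (\<Sum>k\<in>S. f k) = 0 \<longrightarrow> (\<forall>k\<in>S. f k = 0))
   \<and> (\<forall>k. \<exists>B. finite B \<and> Vn k \<subseteq> module.span sc B)
   \<and> (\<exists>N. \<forall>k<N. Vn k = {0})
   \<comment> \<open>bilinearity of the vertex operator map\<close>
   \<and> (\<forall>u n. Vector_Spaces.linear sc sc (Y u n))
   \<and> (\<forall>n v. Vector_Spaces.linear sc sc (\<lambda>u. Y u n v))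
   \<comment> \<open>truncation\<close>
   \<and> (\<forall>u v. \<exists>N. \<forall>n\<ge>N. Y u n v = 0)
   \<comment> \<open>vacuum property Y(1,z) = id\<close>
   \<and> (\<forall>n v. Y vac n v = (if n = -1 then v else 0))
   \<comment> \<open>creation property\<close>
   \<and> (\<forall>v. (\<forall>n\<ge>0. Y v n vac = 0) \<and> Y v (-1) vac = v)
   \<comment> \<open>Jacobi identity (component form)\<close>
   \<and> (\<forall>p q r u v w.
        fsum (\<lambda>i. sc ((of_int p :: complex) gchoose (nat i)) (Y (Y u (r + i) v) (p + q - i) w))
      = fsum (\<lambda>i. sc ((-1) ^ nat i * ((of_int r :: complex) gchoose (nat i))) (Y u (p + r - i) (Y v (q + i) w)))
      - fsum (\<lambda>i. sc ((if even r then 1 else -1) * (-1) ^ nat i * ((of_int r :: complex) gchoose (nat i))) (Y v (q + r - i) (Y u (p + i) w))))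
   \<comment> \<open>Virasoro relations, L(n) = om_(n+1), with central charge c\<close>
   \<and> (\<exists>c::complex. \<forall>m n v.
        Y om (m + 1) (Y om (n + 1) v) - Y om (n + 1) (Y om (m + 1) v)
      = sc (of_int (m - n)) (Y om (m + n + 1) v)
        + sc ((if m + n = 0 then 1 else 0) * (of_int (m ^ 3 - m) / 12) * c) v)
   \<comment> \<open>L(0) acts on V_n as n\<close>
   \<and> (\<forall>k. \<forall>v\<in>Vn k. Y om 1 v = sc (of_int k) v)
   \<comment> \<open>L(-1)-derivative property\<close>
   \<and> (\<forall>u n v. Y (Y om 0 u) n v = sc (- of_int n) (Y u (n - 1) v))"

definition simple_VOA ::
  "(complex \<Rightarrow> 'v::ab_group_add \<Rightarrow> 'v) \<Rightarrow> ('v \<Rightarrow> int \<Rightarrow> 'v \<Rightarrow> 'v) \<Rightarrow> bool" where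
  "simple_VOA sc Y \<longleftrightarrow>
     (\<forall>U. module.subspace sc U \<longrightarrow> (\<forall>v n. \<forall>u\<in>U. Y v n u \<in> U) \<longrightarrow> U = {0} \<or> U = UNIV)"

definition VOA_aut ::
  "(complex \<Rightarrow> 'v::ab_group_add \<Rightarrow> 'v) \<Rightarrow> ('v \<Rightarrow> int \<Rightarrow> 'v \<Rightarrow> 'v) \<Rightarrow> 'v \<Rightarrow> 'v \<Rightarrow> ('v \<Rightarrow> 'v) \<Rightarrow> bool" where
  "VOA_aut sc Y vac om g \<longleftrightarrow>
     Vector_Spaces.linear sc sc g \<and> bij g
   \<and> (\<forall>u n v. g (Y u n v) = Y (g u) n (g v)) \<and> g vac = vac \<and> g om = om"

text \<open>A group of maps 'v => 'v under composition (elements act faithfully automatically).\<close>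
definition map_group :: "('v \<Rightarrow> 'v) set \<Rightarrow> bool" where
  "map_group G \<longleftrightarrow> id \<in> G \<and> (\<forall>g\<in>G. \<forall>h\<in>G. g \<circ> h \<in> G) \<and> (\<forall>g\<in>G. bij g \<and> inv g \<in> G)"

definition map_subgroup :: "('v \<Rightarrow> 'v) set \<Rightarrow> ('v \<Rightarrow> 'v) set \<Rightarrow> bool" where
  "map_subgroup H G \<longleftrightarrow> H \<subseteq> G \<and> map_group H"

definition abelian_maps :: "('v \<Rightarrow> 'v) set \<Rightarrow> bool" where
  "abelian_maps G \<longleftrightarrow> (\<forall>g\<in>G. \<forall>h\<in>G. g \<circ> h = h \<circ> g)"

text \<open>G is dihedral of order 2n: G = <r,s> with r of order n, s an involution outside <r>,
  s r s = r^(-1).  (For n = 1, 2 these groups are abelian, so the convention for small n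
  does not affect the theorem.)\<close>
definition dihedral_maps :: "('v \<Rightarrow> 'v) set \<Rightarrow> bool" where
  "dihedral_maps G \<longleftrightarrow> (\<exists>r s n. n \<ge> 1 \<and> bij r
      \<and> (r ^^ n) = id \<and> (\<forall>k. 0 < k \<and> k < n \<longrightarrow> (r ^^ k) \<noteq> id)
      \<and> s \<circ> s = id \<and> s \<notin> {r ^^ k | k. k < n}
      \<and> s \<circ> r \<circ> s = inv r
      \<and> G = {r ^^ k | k. k < n} \<union> {s \<circ> (r ^^ k) | k. k < n})"

definition fixed_points :: "('v \<Rightarrow> 'v) set \<Rightarrow> 'v set" where
  "fixed_points H = {v. \<forall>h\<in>H. h v = v}"

definition sub_VOA ::
  "(complex \<Rightarrow> 'v::ab_group_add \<Rightarrow> 'v) \<Rightarrow> ('v \<Rightarrow> int \<Rightarrow> 'v \<Rightarrow> 'v) \<Rightarrow> 'v \<Rightarrow> 'v \<Rightarrow> (int \<Rightarrow> 'v set) \<Rightarrow> 'v set \<Rightarrow> bool" where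
  "sub_VOA sc Y vac om Vn W \<longleftrightarrow>
     module.subspace sc W \<and> W \<subseteq> module.span sc (\<Union>k. W \<inter> Vn k)
   \<and> vac \<in> W \<and> om \<in> W \<and> (\<forall>u\<in>W. \<forall>v\<in>W. \<forall>n. Y u n v \<in> W)"

end

theory Submission
  imports Defs "HOL-Computational_Algebra.Fundamental_Theorem_Algebra"
begin

text \<open>
  Let $A$ be the algebra of operators generated by all modes $u_n$. As $V$ is simple with
  finite-dimensional weight spaces, the commutant of $A$ is $\mathbb C$, so $A$ acts densely on $V$;
  and on any finite set of vectors an element of $A$ agrees with a sum of modes.
  For $W$ closed under the products, let $R_W$ be the span of the $V$-valued functions
  $g \mapsto x(gw)$ on $G$ with $x \in A$, $w \in W$. Weak commutativity shows that $R_W$ is stable under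
  $\Phi \mapsto (g \mapsto (gw)_m \Phi(g))$, hence under multiplication by scalar functions $e$ with
  $e \cdot \mathbf 1 \in R_W$; density supplies such $e$ separating elements of $G$ that act differently
  on $W$. So $R_W$ contains $b$ times the indicator function of the pointwise stabilizer $H$ of $W$,
  for every $b \in V$.

  If $V^G \subseteq W$, then $\sum_g g^{-1} \Phi(g) \in W$ for $\Phi \in R_W$, since averaging a mode $u_n$
  over $G$ gives the mode of an invariant vector; with $b \in V^H$ this sum is $|H| b$, so
  $V^H \subseteq W$. Conversely, if $g$ fixes $V^H$ pointwise, then
  $\sum_{h \in H} \Phi(gh) = \sum_{h \in H} \Phi(h)$ on $R_V$, and the indicator function of the identity
  yields $g \in H$.
\<close>

section \<open>Sums of finite support\<close>

lemma fsum_eq_sum: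
  assumes "\<And>i. i \<ge> N \<Longrightarrow> f (int i) = 0"
  shows "fsum f = (\<Sum>i<N. f (int i))"
proof -
  have sub: "{i. i \<ge> 0 \<and> f i \<noteq> 0} \<subseteq> int ` {..<N}"
  proof
    fix i assume "i \<in> {i. i \<ge> 0 \<and> f i \<noteq> 0}"
    then have "i = int (nat i)" "nat i < N"
      using assms[of "nat i"] by (auto intro: leI simp: not_le[symmetric])
    then show "i \<in> int ` {..<N}" by blast
  qed
  have "fsum f = (\<Sum>i\<in>int ` {..<N}. f i)"
    unfolding fsum_def by (rule sum.mono_neutral_left[OF _ sub]) auto
  also have "\<dots> = (\<Sum>i<N. f (int i))"
    by (subst sum.reindex) auto
  finally show ?thesis .
qed

lemma fsum_eq_0: "(\<And>i. i \<ge> 0 \<Longrightarrow> f i = 0) \<Longrightarrow> fsum f = 0"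
  unfolding fsum_def by (rule sum.neutral) auto

section \<open>Eigenvectors\<close>

context vector_space
begin

text \<open>Induction on the degree: for a root z of p write p = (X - z) q. Then q annihilates T v -
  z v. If this vector is zero, v is an eigenvector; otherwise the induction hypothesis applies to
  it. \<open>N\<close> may be any strict bound of the degree.\<close>

lemma eigenvector_if_poly_annihilates:
  assumes T: "Vector_Spaces.linear scale scale T"
    and alg: "\<And>p::'a poly. degree p > 0 \<Longrightarrow> \<exists>z. poly p z = 0"
  shows "p \<noteq> 0 \<Longrightarrow> v \<noteq> 0 \<Longrightarrow> degree p < N \<Longrightarrow> (\<Sum>i<N. scale (coeff p i) ((T ^^ i) v)) = 0
    \<Longrightarrow> \<exists>u c. u \<noteq> 0 \<and> T u = scale c u"
proof (induction "degree p" arbitrary: p v N)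
  case 0
  then obtain N' where N: "N = Suc N'" by (cases N) auto
  have "coeff p (Suc i) = 0" for i using 0 by (simp add: coeff_eq_0)
  then have "scale (coeff p 0) v = 0"
    using 0(5) by (simp add: N sum.lessThan_Suc_shift del: sum.lessThan_Suc)
  moreover have "coeff p 0 \<noteq> 0" using 0 by (metis leading_coeff_0_iff)
  ultimately show ?case using 0 by simp
next
  case (Suc d)
  interpret T: Vector_Spaces.linear scale scale T by (rule T)
  obtain z where "poly p z = 0" using alg[of p] Suc by auto
  then obtain q where p: "p = [:-z, 1:] * q" by (auto simp: poly_eq_0_iff_dvd)
  have "q \<noteq> 0" using Suc(3) p by auto
  then have dp: "degree p = Suc (degree q)" unfolding p by (subst degree_mult_eq) auto
  obtain M where N: "N = Suc M" using Suc(5) by (cases N) auto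
  \<comment> \<open>This lets the sum over the first \<open>Suc M\<close> coefficients of q be cut
    to \<open>M\<close> terms, the length of the shifted sum.\<close>
  have qM: "coeff q M = 0" using Suc(5) dp N by (simp add: coeff_eq_0)
  define v' where "v' = T v - scale z v"
  have Tp: "(T ^^ i) v' = (T ^^ Suc i) v - scale z ((T ^^ i) v)" for i
    by (induction i) (simp_all add: v'_def T.diff T.scale)
  have c0: "coeff p 0 = - z * coeff q 0" by (simp add: p)
  have cS: "coeff p (Suc i) = coeff q i - z * coeff q (Suc i)" for i by (simp add: p)
  have "0 = (\<Sum>i<N. scale (coeff p i) ((T ^^ i) v))" using Suc by simp
  also have "\<dots> = scale (coeff p 0) v + (\<Sum>i<M. scale (coeff p (Suc i)) ((T ^^ Suc i) v))"
    unfolding N by (subst sum.lessThan_Suc_shift) simp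
  also have "\<dots> = (\<Sum>i<M. scale (coeff q i) ((T ^^ Suc i) v))
      - (scale (z * coeff q 0) v + (\<Sum>i<M. scale (z * coeff q (Suc i)) ((T ^^ Suc i) v)))"
    by (simp add: c0 cS scale_left_diff_distrib sum_subtractf del: funpow.simps)
  also have "scale (z * coeff q 0) v + (\<Sum>i<M. scale (z * coeff q (Suc i)) ((T ^^ Suc i) v))
      = (\<Sum>i<Suc M. scale (z * coeff q i) ((T ^^ i) v))"
    by (subst sum.lessThan_Suc_shift) simp
  also have "\<dots> = (\<Sum>i<M. scale (coeff q i) (scale z ((T ^^ i) v)))"
    using qM by (simp add: mult.commute)
  finally have e: "(\<Sum>i<M. scale (coeff q i) ((T ^^ i) v')) = 0"
    unfolding Tp by (simp add: scale_right_diff_distrib sum_subtractf del: funpow.simps)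
  show ?case
  proof (cases "v' = 0")
    case True
    then show ?thesis using Suc(4) by (auto simp: v'_def)
  next
    case False
    have "d = degree q" "degree q < M" using dp Suc(2,5) N by auto
    from Suc(1)[OF this(1) \<open>q \<noteq> 0\<close> False this(2) e] show ?thesis .
  qed
qed

text \<open>The iterates v, T v, T^2 v, ... stay in U, and card B + 1 of them cannot be linearly
  independent; a relation between them is a polynomial annihilating v.\<close>

lemma eigenvector_exists:
  assumes T: "Vector_Spaces.linear scale scale T"
    and alg: "\<And>p::'a poly. degree p > 0 \<Longrightarrow> \<exists>z. poly p z = 0"
    and inv: "\<And>u. u \<in> U \<Longrightarrow> T u \<in> U"
    and fin: "finite B" "U \<subseteq> span B" and v: "v \<in> U" "v \<noteq> 0"
  shows "\<exists>u c. u \<noteq> 0 \<and> T u = scale c u"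
proof -
  define t where "t i = (T ^^ i) v" for i
  have tU: "t i \<in> U" for i by (induction i) (auto simp: t_def v inv)
  define n where "n = Suc (card B)"
  have "\<exists>p. p \<noteq> 0 \<and> degree p < n \<and> (\<Sum>i<n. scale (coeff p i) (t i)) = 0"
  \<comment> \<open>\<open>dependent\<close> speaks of sets, so a repetition among the iterates is
    invisible to it; in that case X^i - X^j annihilates v.\<close>
  proof (cases "inj_on t {..<n}")
    case True
    let ?S = "t ` {..<n}"
    have "dependent ?S"
    proof (rule ccontr)
      assume "independent ?S"
      from independent_span_bound[OF fin(1) this] tU fin(2)
      have "card ?S \<le> card B" by blast
      then show False using card_image[OF True] by (simp add: n_def)
    qed
    then obtain f where f: "\<exists>x\<in>?S. f x \<noteq> 0" "(\<Sum>x\<in>?S. scale (f x) x) = 0"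
      by (subst (asm) dependent_finite) auto
    define p where "p = (\<Sum>i<n. monom (f (t i)) i)"
    have c: "coeff p i = (if i < n then f (t i) else 0)" for i
      by (simp add: p_def coeff_sum sum.delta)
    have "degree p < n"
      by (rule degree_lessI) (auto simp: c n_def)
    moreover obtain i where "i < n" "f (t i) \<noteq> 0" using f(1) by auto
    then have "coeff p i \<noteq> 0" by (simp add: c)
    then have "p \<noteq> 0" by auto
    moreover have "(\<Sum>i<n. scale (coeff p i) (t i)) = 0"
      using f(2) by (subst (asm) sum.reindex[OF True]) (simp add: c)
    ultimately show ?thesis by blast
  next
    case False
    then obtain i j where ij: "i < n" "j < n" "i \<noteq> j" "t i = t j" by (auto simp: inj_on_def)
    define p :: "'a poly" where "p = monom 1 i - monom 1 j"
    have c: "coeff p k = (if k = i then 1 else 0) - (if k = j then 1 else 0)" for k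
      by (auto simp: p_def)
    have "degree p < n" by (rule degree_lessI) (use ij in \<open>auto simp: c\<close>)
    moreover have "coeff p i \<noteq> 0" using ij by (simp add: c)
    then have "p \<noteq> 0" by auto
    moreover have "(\<Sum>k<n. scale (coeff p k) (t k))
      = (\<Sum>k<n. (if k = i then t i else 0)) - (\<Sum>k<n. (if k = j then t j else 0))"
      unfolding sum_subtractf[symmetric] by (rule sum.cong) (auto simp: c)
    then have "(\<Sum>k<n. scale (coeff p k) (t k)) = 0"
      using ij by (simp add: sum.delta)
    ultimately show ?thesis by blast
  qed
  then obtain p where "p \<noteq> 0" "degree p < n" "(\<Sum>i<n. scale (coeff p i) (t i)) = 0" by blast
  from eigenvector_if_poly_annihilates[OF T alg this(1) v(2) this(2)] this(3)
  show ?thesis by (simp add: t_def)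
qed

end

section \<open>Modes of a vertex operator algebra\<close>

locale voa =
  fixes sc :: "complex \<Rightarrow> 'v::ab_group_add \<Rightarrow> 'v"
    and Y :: "'v \<Rightarrow> int \<Rightarrow> 'v \<Rightarrow> 'v"
    and vac om :: 'v
    and Vn :: "int \<Rightarrow> 'v set"
  assumes voa: "is_VOA sc Y vac om Vn"
begin

sublocale VS: vector_space sc
  using voa unfolding is_VOA_def by blast

lemma linear_mode: "Vector_Spaces.linear sc sc (Y u n)"
  and linear_mode_left: "Vector_Spaces.linear sc sc (\<lambda>u. Y u n v)"
  and truncation: "\<exists>N. \<forall>n\<ge>N. Y u n v = 0"
  and vacuum: "Y vac n v = (if n = -1 then v else 0)"
  and creation: "Y v (-1) vac = v"
  and weight: "v \<in> Vn k \<Longrightarrow> Y om 1 v = sc (of_int k) v"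
  and subspace_Vn: "VS.subspace (Vn k)"
  and span_Vn: "VS.span (\<Union>k. Vn k) = UNIV"
  and direct_Vn: "finite S \<Longrightarrow> (\<And>k. k \<in> S \<Longrightarrow> f k \<in> Vn k) \<Longrightarrow> (\<Sum>k\<in>S. f k) = 0
    \<Longrightarrow> k \<in> S \<Longrightarrow> f k = 0"
  and finite_dim_Vn: "\<exists>B. finite B \<and> Vn k \<subseteq> VS.span B"
proof -
  note ax = voa[unfolded is_VOA_def]
  have "\<forall>u n. Vector_Spaces.linear sc sc (Y u n)"
    "\<forall>n v. Vector_Spaces.linear sc sc (\<lambda>u. Y u n v)"
    "\<forall>u v. \<exists>N. \<forall>n\<ge>N. Y u n v = 0"
    "\<forall>n v. Y vac n v = (if n = -1 then v else 0)"
    "\<forall>v. (\<forall>n\<ge>0. Y v n vac = 0) \<and> Y v (-1) vac = v"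
    using ax by - (elim conjE, assumption)+
  then show "Vector_Spaces.linear sc sc (Y u n)" "Vector_Spaces.linear sc sc (\<lambda>u. Y u n v)"
    "\<exists>N. \<forall>n\<ge>N. Y u n v = 0" "Y vac n v = (if n = -1 then v else 0)" "Y v (-1) vac = v"
    by simp_all
  have "\<forall>k. \<forall>v\<in>Vn k. Y om 1 v = sc (of_int k) v" "\<forall>k. VS.subspace (Vn k)"
    "\<forall>k. \<exists>B. finite B \<and> Vn k \<subseteq> VS.span B" "VS.span (\<Union>k. Vn k) = UNIV"
    "\<forall>S f. finite S \<longrightarrow> (\<forall>k\<in>S. f k \<in> Vn k) \<longrightarrow> (\<Sum>k\<in>S. f k) = 0 \<longrightarrow> (\<forall>k\<in>S. f k = 0)"
    using ax by - (elim conjE, assumption)+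
  then show "v \<in> Vn k \<Longrightarrow> Y om 1 v = sc (of_int k) v" "VS.subspace (Vn k)"
    "\<exists>B. finite B \<and> Vn k \<subseteq> VS.span B" "VS.span (\<Union>k. Vn k) = UNIV"
    "finite S \<Longrightarrow> (\<And>k. k \<in> S \<Longrightarrow> f k \<in> Vn k) \<Longrightarrow> (\<Sum>k\<in>S. f k) = 0 \<Longrightarrow> k \<in> S \<Longrightarrow> f k = 0"
    by blast+
qed

lemma jacobi:
  "fsum (\<lambda>i. sc ((of_int p :: complex) gchoose (nat i)) (Y (Y u (r + i) v) (p + q - i) w))
      = fsum (\<lambda>i. sc ((-1) ^ nat i * ((of_int r :: complex) gchoose (nat i))) (Y u (p + r - i) (Y v (q + i) w)))
      - fsum (\<lambda>i. sc ((if even r then 1 else -1) * (-1) ^ nat i * ((of_int r :: complex) gchoose (nat i))) (Y v (q + r - i) (Y u (p + i) w)))"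
  using voa unfolding is_VOA_def by blast

lemma mode_simps [simp]:
  "Y u n 0 = 0" "Y 0 n v = 0"
  "Y u n (v + w) = Y u n v + Y u n w" "Y (u + u') n v = Y u n v + Y u' n v"
  "Y u n (sc c v) = sc c (Y u n v)" "Y (sc c u) n v = sc c (Y u n v)"
  "Y u n (v - w) = Y u n v - Y u n w"
proof -
  interpret a: Vector_Spaces.linear sc sc "Y u n" by (rule linear_mode)
  interpret b: Vector_Spaces.linear sc sc "\<lambda>u. Y u n v" by (rule linear_mode_left)
  show "Y u n 0 = 0" "Y 0 n v = 0"
    "Y u n (v + w) = Y u n v + Y u n w" "Y (u + u') n v = Y u n v + Y u' n v"
    "Y u n (sc c v) = sc c (Y u n v)" "Y (sc c u) n v = sc c (Y u n v)"
    "Y u n (v - w) = Y u n v - Y u n w"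
    by (rule a.zero b.zero a.add b.add a.scale b.scale a.diff)+
qed

lemma mode_sum_left: "Y (\<Sum>i\<in>I. f i) n v = (\<Sum>i\<in>I. Y (f i) n v)"
  by (induction I rule: infinite_finite_induct) auto

lemma mode_sum: "Y u n (\<Sum>i\<in>I. f i) = (\<Sum>i\<in>I. Y u n (f i))"
  by (induction I rule: infinite_finite_induct) auto

lemma truncation_finite:
  "finite F \<Longrightarrow> \<exists>N. \<forall>(u, v)\<in>F. \<forall>n\<ge>N. Y u n v = 0"
proof (induction F rule: finite_induct)
  case (insert x F)
  obtain u v where x: "x = (u, v)" by force
  obtain N where N: "\<forall>(u, v)\<in>F. \<forall>n\<ge>N. Y u n v = 0" using insert by blast
  obtain M where "\<forall>n\<ge>M. Y u n v = 0" using truncation by blast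
  then have "\<forall>(u, v)\<in>insert x F. \<forall>n\<ge>max N M. Y u n v = 0" using N x by auto
  then show ?case by blast
qed auto

section \<open>Sums of modes and the algebra they generate\<close>

inductive_set modes :: "('v \<Rightarrow> 'v) set" where
  mode: "Y u n \<in> modes"
| add: "x \<in> modes \<Longrightarrow> y \<in> modes \<Longrightarrow> (\<lambda>v. x v + y v) \<in> modes"

text \<open>Multiplication by c is the mode \<open>Y (sc c vac) (-1)\<close>, so this is a unital
  algebra over the complex numbers.\<close>

inductive_set mode_algebra :: "('v \<Rightarrow> 'v) set" where
  mode: "Y u n \<in> mode_algebra"
| add: "x \<in> mode_algebra \<Longrightarrow> y \<in> mode_algebra \<Longrightarrow> (\<lambda>v. x v + y v) \<in> mode_algebra"
| comp: "x \<in> mode_algebra \<Longrightarrow> y \<in> mode_algebra \<Longrightarrow> (\<lambda>v. x (y v)) \<in> mode_algebra"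

text \<open>The expansion of a product of two modes into modes depends on the vectors it is applied
  to. Agreement is therefore demanded on F only, but with one sum of modes for all of F.\<close>

definition locally_modes :: "'v set \<Rightarrow> ('v \<Rightarrow> 'v) set" where
  "locally_modes F = {x. \<exists>s\<in>modes. \<forall>v\<in>F. x v = s v}"

lemma locally_modes_mode: "Y u n \<in> locally_modes F"
  unfolding locally_modes_def using modes.mode by blast

lemma locally_modes_zero: "(\<And>v. v \<in> F \<Longrightarrow> x v = 0) \<Longrightarrow> x \<in> locally_modes F"
  unfolding locally_modes_def by (auto intro!: bexI[OF _ modes.mode[of 0 0]])

lemma locally_modes_add:
  assumes "x \<in> locally_modes F" "y \<in> locally_modes F"
  shows "(\<lambda>v. x v + y v) \<in> locally_modes F"
proof -
  obtain s t where "s \<in> modes" "\<forall>v\<in>F. x v = s v" "t \<in> modes" "\<forall>v\<in>F. y v = t v"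
    using assms unfolding locally_modes_def by blast
  then show ?thesis
    unfolding locally_modes_def by (auto intro!: bexI[of _ "\<lambda>v. s v + t v"] modes.add)
qed

lemma modes_scale: "x \<in> modes \<Longrightarrow> (\<lambda>v. sc c (x v)) \<in> modes"
proof (induction rule: modes.induct)
  case (mode u n)
  have "(\<lambda>v. sc c (Y u n v)) = Y (sc c u) n" by auto
  then show ?case using modes.mode by simp
next
  case (add x y)
  then show ?case using modes.add[OF add.IH] by (simp add: VS.scale_right_distrib)
qed

lemma locally_modes_scale: "x \<in> locally_modes F \<Longrightarrow> (\<lambda>v. sc c (x v)) \<in> locally_modes F"
  unfolding locally_modes_def using modes_scale by fastforce

lemma locally_modes_sum:
  "(\<And>i. i \<in> I \<Longrightarrow> x i \<in> locally_modes F) \<Longrightarrow> (\<lambda>v. \<Sum>i\<in>I. x i v) \<in> locally_modes F"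
  by (induction I rule: infinite_finite_induct)
    (auto intro: locally_modes_zero locally_modes_add)

lemma locally_modes_cong:
  "x \<in> locally_modes F \<Longrightarrow> (\<And>v. v \<in> F \<Longrightarrow> x v = y v) \<Longrightarrow> y \<in> locally_modes F"
  unfolding locally_modes_def by fastforce

text \<open>Taking $p$ so large that $u_{p+i}w = 0$ for all $w \in F$ removes the last sum of the Jacobi
  identity; the first term of the middle sum is the wanted product, and its other terms
  have a larger second index.\<close>

lemma mode_comp_locally_modes:
  assumes F: "finite F"
  shows "(\<lambda>w. Y u m (Y v q w)) \<in> locally_modes F"
proof -
  obtain p where p: "\<And>n w. n \<ge> p \<Longrightarrow> w \<in> F \<Longrightarrow> Y u n w = 0"
    using truncation_finite[of "Pair u ` F"] F by auto
  \<comment> \<open>From the index \<open>Q\<close> on, the modes of v annihilate F; this starts the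
    descending induction on q.\<close>
  obtain Q where Q: "\<And>n w. n \<ge> Q \<Longrightarrow> w \<in> F \<Longrightarrow> Y v n w = 0"
    using truncation_finite[of "Pair v ` F"] F by auto
  show ?thesis
  proof (induction "nat (Q - q)" arbitrary: m q rule: less_induct)
    case less
    show ?case
    proof (cases "q \<ge> Q")
      case True
      then show ?thesis by (intro locally_modes_zero) (simp add: Q)
    next
      case False
      \<comment> \<open>Terms whose second index q + i reaches \<open>Q\<close> vanish, so the
        middle sum of the Jacobi identity has \<open>Suc d\<close> terms.\<close>
      define d where "d = nat (Q - q - 1)"
      have d: "Suc d = nat (Q - q)" "int d = Q - q - 1" using False by (auto simp: d_def)
      \<comment> \<open>With this r the first term of the middle sum is u_(p+r) v_q = u_m
        v_q.\<close>
      define r where "r = m - p"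
      obtain N where N: "\<And>n. n \<ge> N \<Longrightarrow> Y u n v = 0" using truncation by blast
      define c where "c i = (-1) ^ i * ((of_int r :: complex) gchoose i)" for i
      define M where "M = nat (N - r)"
      let ?L = "\<lambda>w. \<Sum>i<M. sc ((of_int p :: complex) gchoose i) (Y (Y u (r + int i) v) (p + q - int i) w)"
      let ?R = "\<lambda>w. \<Sum>i<d. sc (- c (Suc i)) (Y u (m - 1 - int i) (Y v (q + 1 + int i) w))"
      have eq: "?L w + ?R w = Y u m (Y v q w)" if w: "w \<in> F" for w
      proof -
        have "?L w = fsum (\<lambda>i. sc ((of_int p :: complex) gchoose (nat i)) (Y (Y u (r + i) v) (p + q - i) w))"
          by (subst fsum_eq_sum[of M]) (auto simp: N M_def)
        also have "\<dots> = fsum (\<lambda>i. sc ((-1) ^ nat i * ((of_int r :: complex) gchoose (nat i))) (Y u (p + r - i) (Y v (q + i) w)))"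
          unfolding jacobi by (simp add: fsum_eq_0 p w)
        also have "\<dots> = (\<Sum>i<Suc d. sc (c i) (Y u (m - int i) (Y v (q + int i) w)))"
          by (subst fsum_eq_sum[of "Suc d"]) (use d in \<open>auto simp: Q w c_def r_def\<close>)
        also have "\<dots> = Y u m (Y v q w) - ?R w"
          by (subst sum.lessThan_Suc_shift)
            (simp add: c_def sum_negf algebra_simps)
        finally show ?thesis by simp
      qed
      have L: "?L \<in> locally_modes F"
        by (intro locally_modes_sum locally_modes_scale locally_modes_mode)
      have R: "?R \<in> locally_modes F"
        by (intro locally_modes_sum locally_modes_scale less) (use False in auto)
      show ?thesis by (rule locally_modes_cong[OF locally_modes_add[OF L R] eq])
    qed
  qed
qed

lemma linear_add:
  "Vector_Spaces.linear sc sc f \<Longrightarrow> Vector_Spaces.linear sc sc g \<Longrightarrow> Vector_Spaces.linear sc sc (\<lambda>v. f v + g v)"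
  by (auto simp: Vector_Spaces.linear_iff VS.scale_right_distrib)

lemma mode_algebra_linear: "x \<in> mode_algebra \<Longrightarrow> Vector_Spaces.linear sc sc x"
proof (induction rule: mode_algebra.induct)
  case (comp x y)
  then show ?case using Vector_Spaces.linear_compose[of sc sc y sc x] by (simp add: o_def)
qed (auto intro: linear_mode linear_add)

lemma modes_comp:
  assumes "s \<in> modes" "t \<in> modes" "finite F"
  shows "(\<lambda>v. s (t v)) \<in> locally_modes F"
  using assms(1,2)
proof (induction arbitrary: t rule: modes.induct)
  case (mode u n)
  from mode show ?case
    by (induction rule: modes.induct)
      (auto intro: mode_comp_locally_modes[OF assms(3)] dest: locally_modes_add)
qed (auto intro: locally_modes_add)

lemma mode_algebra_locally_modes:
  assumes "x \<in> mode_algebra" "finite F"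
  shows "x \<in> locally_modes F"
  using assms
proof (induction arbitrary: F rule: mode_algebra.induct)
  case (comp x y)
  obtain t where t: "t \<in> modes" "\<And>v. v \<in> F \<Longrightarrow> y v = t v"
    using comp.IH(2)[OF comp.prems] unfolding locally_modes_def by blast
  obtain s where s: "s \<in> modes" "\<And>v. v \<in> t ` F \<Longrightarrow> x v = s v"
    using comp.IH(1)[of "t ` F"] comp.prems unfolding locally_modes_def by blast
  from modes_comp[OF s(1) t(1) comp.prems] show ?case
    by (rule locally_modes_cong) (simp add: s t)
qed (auto intro: locally_modes_mode locally_modes_add)

lemma id_mode_algebra: "(\<lambda>v. v) \<in> mode_algebra"
proof -
  have "Y vac (-1) = (\<lambda>v. v)" by (auto simp: vacuum)
  then show ?thesis using mode_algebra.mode[of vac "-1"] by simp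
qed

lemma scale_mode_algebra: "(\<lambda>v. sc c v) \<in> mode_algebra"
proof -
  have "Y (sc c vac) (-1) = (\<lambda>v. sc c v)" by (auto simp: vacuum)
  then show ?thesis using mode_algebra.mode[of "sc c vac" "-1"] by simp
qed

text \<open>V_k is the eigenspace of L(0) = om_1 for the eigenvalue k, so anything commuting with
  L(0) preserves it. This serves both for the commutant of the modes and for automorphisms.\<close>

lemma commutes_weight_Vn:
  assumes T: "Vector_Spaces.linear sc sc T" and com: "\<And>v. T (Y om 1 v) = Y om 1 (T v)"
    and v: "v \<in> Vn k"
  shows "T v \<in> Vn k"
proof -
  interpret T: Vector_Spaces.linear sc sc T by (rule T)
  have "T v \<in> VS.span (\<Union>k. Vn k)" using span_Vn by auto
  then obtain S f where S: "finite S" "\<And>j. j \<in> S \<Longrightarrow> f j \<in> Vn j" "T v = (\<Sum>j\<in>S. f j)"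
  proof (induction arbitrary: thesis rule: VS.span_induct_alt)
    case base
    show ?case by (rule base[of "{}"]) auto
  next
    case (step c x y)
    obtain S f where S: "finite S" "\<And>j. j \<in> S \<Longrightarrow> f j \<in> Vn j" "y = (\<Sum>j\<in>S. f j)"
      using step.IH by blast
    obtain i where i: "x \<in> Vn i" using step.hyps by blast
    define g where "g j = (if j \<in> S then f j else 0) + (if j = i then sc c x else 0)" for j
    show ?case
    proof (rule step.prems[of "insert i S" g])
      fix j
      have "(if j \<in> S then f j else 0) \<in> Vn j" "(if j = i then sc c x else 0) \<in> Vn j"
        using S i VS.subspace_0[OF subspace_Vn] VS.subspace_scale[OF subspace_Vn] by auto
      then show "g j \<in> Vn j" unfolding g_def by (rule VS.subspace_add[OF subspace_Vn])
      have "(\<Sum>j\<in>S. f j) = (\<Sum>j\<in>insert i S. if j \<in> S then f j else 0)"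
        by (rule sum.mono_neutral_cong_left) (use S in auto)
      then show "sc c x + y = (\<Sum>j\<in>insert i S. g j)"
        using S by (simp add: g_def sum.distrib sum.delta add.commute)
    qed (use S in auto)
  qed
  \<comment> \<open>L(0) - k annihilates T v and multiplies its component of weight j by j - k;
    directness of the grading then kills every component with j different from k.\<close>
  have "(\<Sum>j\<in>S. sc (of_int j - of_int k) (f j)) = (\<Sum>j\<in>S. Y om 1 (f j)) - (\<Sum>j\<in>S. sc (of_int k) (f j))"
    unfolding sum_subtractf[symmetric] VS.scale_left_diff_distrib
    by (simp add: weight[OF S(2)])
  also have "\<dots> = Y om 1 (T v) - sc (of_int k) (T v)"
    by (simp add: S mode_sum VS.scale_sum_right)
  also have "\<dots> = 0"
    using weight[OF v] com[of v] by (simp add: T.scale)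
  finally have 0: "(\<Sum>j\<in>S. sc (of_int j - of_int k) (f j)) = 0" .
  have "sc (of_int j - of_int k) (f j) = 0" if "j \<in> S" for j
    by (rule direct_Vn[OF S(1) _ 0 that]) (use S VS.subspace_scale[OF subspace_Vn] in auto)
  then have "f j = 0" if "j \<in> S" "j \<noteq> k" for j
    using that by fastforce
  then have "f j \<in> Vn k" if "j \<in> S" for j
    using that S VS.subspace_0[OF subspace_Vn] by (cases "j = k") auto
  then show ?thesis
    unfolding S(3) by (rule VS.subspace_sum[OF subspace_Vn])
qed

end

section \<open>Density\<close>

locale simple_voa = voa sc Y vac om Vn
  for sc :: "complex \<Rightarrow> 'v::ab_group_add \<Rightarrow> 'v"
    and Y :: "'v \<Rightarrow> int \<Rightarrow> 'v \<Rightarrow> 'v"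
    and vac om :: 'v
    and Vn :: "int \<Rightarrow> 'v set" +
  assumes simple: "simple_VOA sc Y"
begin

lemma simple_subspace:
  assumes "VS.subspace U" "\<And>v n u. u \<in> U \<Longrightarrow> Y v n u \<in> U" "u \<in> U" "u \<noteq> 0"
  shows "U = UNIV"
  using simple assms unfolding simple_VOA_def by blast

text \<open>Schur's lemma: T preserves a nonzero finite-dimensional V_k, hence has an eigenvector,
  and its eigenspace is invariant under all modes, so by simplicity it is everything.\<close>

lemma commutant_scalar:
  assumes T: "Vector_Spaces.linear sc sc T" and com: "\<And>u n v. T (Y u n v) = Y u n (T v)"
  shows "\<exists>c. \<forall>v. T v = sc c v"
\<comment> \<open>\<open>simple_VOA\<close> admits the zero space, which has no eigenvector.\<close>
proof (cases "\<forall>v::'v. v = 0")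
  case True
  then show ?thesis by metis
next
  case False
  interpret T: Vector_Spaces.linear sc sc T by (rule T)
  have "\<exists>k. \<exists>v\<in>Vn k. v \<noteq> 0"
  proof (rule ccontr)
    assume "\<not> ?thesis"
    then have "(\<Union>k. Vn k) \<subseteq> {0}" by blast
    then have "VS.span (\<Union>k. Vn k) \<subseteq> {0}" by (rule VS.span_minimal) (rule VS.subspace_single_0)
    then show False using False span_Vn by auto
  qed
  then obtain k v where v: "v \<in> Vn k" "v \<noteq> 0" by blast
  obtain B where B: "finite B" "Vn k \<subseteq> VS.span B" using finite_dim_Vn by blast
  have "\<exists>u c. u \<noteq> 0 \<and> T u = sc c u"
    by (rule VS.eigenvector_exists[OF T alg_closed_imp_poly_has_root commutes_weight_Vn[OF T com] B v])
  then obtain u c where u: "u \<noteq> 0" "T u = sc c u" by blast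
  have "{v. T v = sc c v} = UNIV"
  proof (rule simple_subspace[OF _ _ _ u(1)])
    show "VS.subspace {v. T v = sc c v}"
      by (rule VS.subspaceI)
        (auto simp: T.add T.scale VS.scale_right_distrib VS.scale_left_commute)
  qed (use u com in auto)
  then show ?thesis by blast
qed

text \<open>The vectors y v with y in J form a nonzero subspace invariant under all modes. It is
  applied to the whole algebra and to the annihilator of a finite set.\<close>

lemma left_ideal_transitive:
  assumes add: "\<And>x y. x \<in> J \<Longrightarrow> y \<in> J \<Longrightarrow> (\<lambda>v. x v + y v) \<in> J"
    and mult: "\<And>a x. a \<in> mode_algebra \<Longrightarrow> x \<in> J \<Longrightarrow> (\<lambda>v. a (x v)) \<in> J"
    and x: "x \<in> J" "x v \<noteq> 0"
  shows "\<exists>y\<in>J. w = y v"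
proof -
  have "(\<lambda>y. y v) ` J = UNIV"
  proof (rule simple_subspace[where u = "x v"])
    show "VS.subspace ((\<lambda>y. y v) ` J)"
    proof (rule VS.subspaceI)
      show "0 \<in> (\<lambda>y. y v) ` J"
        by (rule image_eqI[OF _ mult[OF scale_mode_algebra[of 0] x(1)]]) simp
    next
      fix a b assume "a \<in> (\<lambda>y. y v) ` J" "b \<in> (\<lambda>y. y v) ` J"
      then obtain y z where "y \<in> J" "z \<in> J" "a = y v" "b = z v" by blast
      then show "a + b \<in> (\<lambda>y. y v) ` J" by (intro image_eqI[OF _ add[of y z]]) auto
    next
      fix c a assume "a \<in> (\<lambda>y. y v) ` J"
      then obtain y where "y \<in> J" "a = y v" by blast
      then show "sc c a \<in> (\<lambda>y. y v) ` J" by (intro image_eqI[OF _ mult[OF scale_mode_algebra]]) auto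
    qed
    fix u n a assume "a \<in> (\<lambda>y. y v) ` J"
    then obtain y where "y \<in> J" "a = y v" by blast
    then show "Y u n a \<in> (\<lambda>y. y v) ` J" by (intro image_eqI[OF _ mult[OF mode_algebra.mode]]) auto
  qed (use x in auto)
  then show ?thesis by blast
qed

text \<open>Jacobson density by induction on B. Let J be the annihilator of B and b a new vector
  outside its span, so that J b = V. If every x in J with x b = 0 also killed v, then x b \<mapsto>
  x v would be a well-defined map commuting with all modes, hence a scalar c; J would kill v - c b,
  which puts v in the span of b and B.\<close>

lemma density:
  assumes "finite B" "v \<notin> VS.span B"
  shows "\<exists>x\<in>mode_algebra. (\<forall>b\<in>B. x b = 0) \<and> x v \<noteq> 0"
  using assms
proof (induction B arbitrary: v rule: finite_induct)
  case empty
  then show ?case using id_mode_algebra by auto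
next
  case (insert b B)
  show ?case
  proof (cases "b \<in> VS.span B")
    case True
    then have "VS.span (insert b B) = VS.span B" by (rule VS.span_redundant)
    then obtain x where x: "x \<in> mode_algebra" "\<forall>b\<in>B. x b = 0" "x v \<noteq> 0"
      using insert by blast
    interpret x: Vector_Spaces.linear sc sc x by (rule mode_algebra_linear) fact
    have "x b = 0" using x.eq_0_on_span[OF _ True] x(2) by blast
    then show ?thesis using x by blast
  next
    case False
    define J where "J = {x\<in>mode_algebra. \<forall>b\<in>B. x b = 0}"
    have J_add: "(\<lambda>v. x v + y v) \<in> J" if "x \<in> J" "y \<in> J" for x y
      using that by (auto simp: J_def intro: mode_algebra.add)
    have J_mult: "(\<lambda>v. a (x v)) \<in> J" if "a \<in> mode_algebra" "x \<in> J" for a x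
    proof -
      interpret a: Vector_Spaces.linear sc sc a by (rule mode_algebra_linear) fact
      show ?thesis using that by (auto simp: J_def intro: mode_algebra.comp)
    qed
    note J_scale = J_mult[OF scale_mode_algebra]
    obtain x0 where x0: "x0 \<in> J" "x0 b \<noteq> 0" using insert.IH[OF False] by (auto simp: J_def)
    have ex: "\<exists>x\<in>J. y = x b" for y
      by (rule left_ideal_transitive[where J = J and x = x0]) (use J_add J_mult x0 in auto)
    show ?thesis
    proof (rule ccontr)
      assume neg: "\<not> ?thesis"
      have kill: "x v = 0" if "x \<in> J" "x b = 0" for x
        using neg that by (auto simp: J_def)
      \<comment> \<open>The choice of x is immaterial: two choices differ by an element of J killing
        b, hence v.\<close>
      define T where "T y = (SOME x. x \<in> J \<and> x b = y) v" for y
      have T: "T (x b) = x v" if x: "x \<in> J" for x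
      proof -
        define y where "y = (SOME y. y \<in> J \<and> y b = x b)"
        have y: "y \<in> J" "y b = x b"
          using someI[of "\<lambda>y. y \<in> J \<and> y b = x b", OF conjI[OF x refl]] unfolding y_def by auto
        have "y v + sc (-1) (x v) = 0"
          by (rule kill[OF J_add[OF y(1) J_scale[OF x]]]) (simp add: y)
        then show ?thesis by (simp add: T_def y_def)
      qed
      have "Vector_Spaces.linear sc sc T"
        unfolding Vector_Spaces.linear_iff
      proof (intro conjI allI VS.vector_space_axioms)
        fix y z c
        obtain x x' where x: "x \<in> J" "y = x b" "x' \<in> J" "z = x' b" using ex by metis
        show "T (y + z) = T y + T z"
          using T[OF J_add[OF x(1,3)]] by (simp add: x T)
        show "T (sc c y) = sc c (T y)"
          using T[OF J_scale[OF x(1)]] by (simp add: x T)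
      qed
      moreover have "T (Y u n y) = Y u n (T y)" for u n y
      proof -
        obtain x where x: "x \<in> J" "y = x b" using ex by blast
        show ?thesis using T[OF J_mult[OF mode_algebra.mode x(1)]] by (simp add: x T)
      qed
      ultimately obtain c where c: "\<And>y. T y = sc c y" using commutant_scalar by blast
      \<comment> \<open>Otherwise the induction hypothesis gives x in J not killing v - c b,
        although x v = T (x b) = c x b.\<close>
      have "v - sc c b \<in> VS.span B"
      proof (rule ccontr)
        assume "v - sc c b \<notin> VS.span B"
        then obtain x where x: "x \<in> J" "x (v - sc c b) \<noteq> 0"
          using insert.IH by (auto simp: J_def)
        interpret x: Vector_Spaces.linear sc sc x
          using x by (auto simp: J_def intro: mode_algebra_linear)
        show False using x T[OF x(1)] c by (simp add: x.diff x.scale)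
      qed
      then have "v \<in> VS.span (insert b B)" unfolding VS.span_breakdown_eq by blast
      then show False using insert.prems by blast
    qed
  qed
qed

lemma mode_algebra_transitive: "v \<noteq> 0 \<Longrightarrow> \<exists>x\<in>mode_algebra. w = x v"
  by (rule left_ideal_transitive[where J = mode_algebra and x = "\<lambda>v. v"])
    (auto intro: mode_algebra.intros id_mode_algebra)

text \<open>A linear functional that is 1 at v, realised as an operator with values in the line of
  \<open>vac\<close>: extend v to a basis of the span, kill the other basis vectors by density, and
  move the image of v to \<open>vac\<close>.\<close>

lemma mode_algebra_functional:
  assumes F: "finite F" and v: "v \<noteq> 0"
  shows "\<exists>x\<in>mode_algebra. x v = vac \<and> (\<forall>u\<in>F. \<exists>c. x u = sc c vac)"
proof -
  have "VS.independent {v}" using v by simp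
  then obtain B where B: "{v} \<subseteq> B" "B \<subseteq> insert v F" "VS.independent B" "insert v F \<subseteq> VS.span B"
    using VS.maximal_independent_subset_extend[of "{v}" "insert v F"] by blast
  have fB: "finite (B - {v})" using B F by (meson finite.insertI finite_Diff finite_subset)
  have "v \<notin> VS.span (B - {v})" using B unfolding VS.dependent_def by auto
  from density[OF fB this] obtain x where
    x: "x \<in> mode_algebra" "\<forall>b\<in>B - {v}. x b = 0" "x v \<noteq> 0" by blast
  obtain y where y: "y \<in> mode_algebra" "y (x v) = vac"
    using mode_algebra_transitive[OF x(3), of vac] by auto
  interpret x: Vector_Spaces.linear sc sc x by (rule mode_algebra_linear) fact
  interpret y: Vector_Spaces.linear sc sc y by (rule mode_algebra_linear) fact
  have "\<exists>c. y (x u) = sc c vac" if "u \<in> F" for u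
  proof -
    have "u \<in> VS.span (insert v (B - {v}))" using B that by (auto simp: insert_absorb)
    then obtain c where "u - sc c v \<in> VS.span (B - {v})" unfolding VS.span_breakdown_eq by blast
    then have "x (u - sc c v) = 0" using x.eq_0_on_span x(2) by blast
    then have "y (x u) = sc c vac" by (simp add: x.diff x.scale y.scale y)
    then show ?thesis by blast
  qed
  then show ?thesis using mode_algebra.comp[OF y(1) x(1)] y by (intro bexI) auto
qed

end

section \<open>Finite groups of automorphisms\<close>

locale voa_galois = simple_voa sc Y vac om Vn
  for sc :: "complex \<Rightarrow> 'v::ab_group_add \<Rightarrow> 'v"
    and Y :: "'v \<Rightarrow> int \<Rightarrow> 'v \<Rightarrow> 'v"
    and vac om :: 'v
    and Vn :: "int \<Rightarrow> 'v set" +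
  fixes G :: "('v \<Rightarrow> 'v) set"
  assumes group: "map_group G" and finite_G: "finite G"
    and aut: "\<forall>g\<in>G. VOA_aut sc Y vac om g"
begin

lemma
  shows id_in_G: "id \<in> G"
    and comp_in_G: "g \<in> G \<Longrightarrow> h \<in> G \<Longrightarrow> g \<circ> h \<in> G"
    and inv_in_G: "g \<in> G \<Longrightarrow> inv g \<in> G"
    and bij_G: "g \<in> G \<Longrightarrow> bij g"
  using group unfolding map_group_def by blast+

lemma
  assumes "g \<in> G"
  shows G_linear: "Vector_Spaces.linear sc sc g"
    and G_mode: "g (Y u n v) = Y (g u) n (g v)"
    and G_vac: "g vac = vac" and G_om: "g om = om"
  using aut assms unfolding VOA_aut_def by blast+

lemma G_inv_cancel: "g \<in> G \<Longrightarrow> inv g (g v) = v" "g \<in> G \<Longrightarrow> g (inv g v) = v"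
  using bij_G[of g] by (simp_all add: bij_is_inj bij_is_surj surj_f_inv_f)

lemma G_add: "g \<in> G \<Longrightarrow> g (v + w) = g v + g w"
  and G_scale: "g \<in> G \<Longrightarrow> g (sc c v) = sc c (g v)"
  and G_sum: "g \<in> G \<Longrightarrow> g (\<Sum>i\<in>I. f i) = (\<Sum>i\<in>I. g (f i))"
proof -
  assume "g \<in> G"
  then interpret g: Vector_Spaces.linear sc sc g by (rule G_linear)
  show "g (v + w) = g v + g w" "g (sc c v) = sc c (g v)" "g (\<Sum>i\<in>I. f i) = (\<Sum>i\<in>I. g (f i))"
    by (rule g.add g.scale g.sum)+
qed

section \<open>Invariants of subgroups\<close>

lemma fixed_pointsD: "v \<in> fixed_points H \<Longrightarrow> h \<in> H \<Longrightarrow> h v = v"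
  and fixed_pointsI: "(\<And>h. h \<in> H \<Longrightarrow> h v = v) \<Longrightarrow> v \<in> fixed_points H"
  by (simp_all add: fixed_points_def)

lemma subspace_fixed_points:
  assumes "H \<subseteq> G"
  shows "VS.subspace (fixed_points H)"
proof (rule VS.subspaceI)
  have "g 0 = 0" if "g \<in> G" for g using G_scale[OF that, of 0 0] by simp
  then show "0 \<in> fixed_points H" using assms by (auto simp: fixed_points_def)
  show "v + w \<in> fixed_points H" if "v \<in> fixed_points H" "w \<in> fixed_points H" for v w
  proof -
    have "h (v + w) = v + w" if "h \<in> H" for h
      using G_add[of h v w] fixed_pointsD[of v H h] fixed_pointsD[of w H h] that assms \<open>v \<in> _\<close> \<open>w \<in> _\<close>
      by (simp add: subset_iff)
    then show ?thesis by (rule fixed_pointsI)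
  qed
  show "sc c v \<in> fixed_points H" if "v \<in> fixed_points H" for c v
  proof -
    have "h (sc c v) = sc c v" if "h \<in> H" for h
      using G_scale[of h c v] fixed_pointsD[of v H h] that assms \<open>v \<in> _\<close>
      by (simp add: subset_iff)
    then show ?thesis by (rule fixed_pointsI)
  qed
qed

lemma sum_orbit_fixed:
  assumes "map_subgroup H G"
  shows "(\<Sum>h\<in>H. h v) \<in> fixed_points H"
proof -
  have H: "H \<subseteq> G" "map_group H" using assms by (auto simp: map_subgroup_def)
  have "k (\<Sum>h\<in>H. h v) = (\<Sum>h\<in>H. h v)" if k: "k \<in> H" for k
  proof -
    have kG: "k \<in> G" "inv k \<in> H" using H k unfolding map_group_def by auto
    have eq: "(\<Sum>h\<in>H. h v) = (\<Sum>h\<in>H. (k \<circ> h) v)"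
    proof (rule sum.reindex_bij_witness[of _ "\<lambda>h. k \<circ> h" "\<lambda>h. inv k \<circ> h"])
      fix h assume h: "h \<in> H"
      show "inv k \<circ> (k \<circ> h) = h" "k \<circ> (inv k \<circ> h) = h"
        using G_inv_cancel[OF kG(1)] by (auto simp: fun_eq_iff)
      show "k \<circ> h \<in> H" "inv k \<circ> h \<in> H" using H h k kG unfolding map_group_def by auto
      show "(k \<circ> (inv k \<circ> h)) v = h v" using G_inv_cancel[OF kG(1)] by simp
    qed
    have "k (\<Sum>h\<in>H. h v) = (\<Sum>h\<in>H. (k \<circ> h) v)" by (simp add: G_sum[OF kG(1)])
    then show ?thesis by (rule trans[OF _ eq[symmetric]])
  qed
  then show ?thesis by (auto simp: fixed_points_def)
qed

text \<open>The grading is the point with content. Automorphisms fix \<open>om\<close>, so they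
  commute with L(0) and preserve each V_k; summing over H therefore sends homogeneous vectors to
  homogeneous invariants, and it is multiplication by |H| on invariants.\<close>

lemma sub_VOA_fixed_points:
  assumes HG: "map_subgroup H G"
  shows "sub_VOA sc Y vac om Vn (fixed_points H)"
  unfolding sub_VOA_def
proof (intro conjI ballI allI subsetI)
  have H: "H \<subseteq> G" "id \<in> H" "finite H"
    using HG finite_G by (auto simp: map_subgroup_def map_group_def intro: finite_subset)
  let ?W = "fixed_points H"
  show "VS.subspace ?W" by (rule subspace_fixed_points[OF H(1)])
  show "vac \<in> ?W" "om \<in> ?W" using H(1) by (auto simp: fixed_points_def subset_iff G_vac G_om)
  show "Y u n v \<in> ?W" if "u \<in> ?W" "v \<in> ?W" for u v n
  proof -
    have "h (Y u n v) = Y u n v" if "h \<in> H" for h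
      using G_mode[of h u n v] fixed_pointsD[of u H h] fixed_pointsD[of v H h] that H(1) \<open>u \<in> ?W\<close> \<open>v \<in> ?W\<close>
      by (simp add: subset_iff)
    then show ?thesis by (rule fixed_pointsI)
  qed
  fix v assume v: "v \<in> ?W"
  let ?P = "\<lambda>v. \<Sum>h\<in>H. h v"
  have "?P v \<in> VS.span (\<Union>k. ?W \<inter> Vn k)" if "v \<in> VS.span (\<Union>k. Vn k)" for v
    using that
  proof (induction rule: VS.span_induct_alt)
    case base
    have "h 0 = 0" if "h \<in> H" for h using G_scale[of h 0 0] that H by auto
    then have "(\<Sum>h\<in>H. h 0) = 0" by (intro sum.neutral) blast
    then show ?case using VS.span_zero by simp
  next
    case (step c x y)
    obtain k where k: "x \<in> Vn k" using step by blast
    have "h x \<in> Vn k" if "h \<in> H" for h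
    proof (rule commutes_weight_Vn[OF G_linear _ k])
      show "h \<in> G" using that H by blast
      then show "h (Y om 1 v) = Y om 1 (h v)" for v by (simp add: G_mode[of h] G_om[of h])
    qed
    then have "?P x \<in> Vn k" by (rule VS.subspace_sum[OF subspace_Vn])
    then have "?P x \<in> VS.span (\<Union>k. ?W \<inter> Vn k)"
      using sum_orbit_fixed[OF HG] by (intro VS.span_base) blast
    moreover have "?P (sc c x + y) = sc c (?P x) + ?P y"
      unfolding VS.scale_sum_right sum.distrib[symmetric]
    proof (rule sum.cong[OF refl])
      fix h assume "h \<in> H"
      then have "h \<in> G" using H by blast
      then show "h (sc c x + y) = sc c (h x) + h y" by (simp add: G_add[of h] G_scale[of h])
    qed
    ultimately show ?case using step.IH by (simp add: VS.span_add VS.span_scale)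
  qed
  then have "?P v \<in> VS.span (\<Union>k. ?W \<inter> Vn k)" using span_Vn by blast
  moreover have "?P v = sc (of_nat (card H)) v"
    using sum.cong[OF refl fixed_pointsD[OF v], of H] by (simp add: VS.sum_constant_scale)
  moreover have "of_nat (card H) \<noteq> (0::complex)" using H by auto
  ultimately show "v \<in> VS.span (\<Union>k. ?W \<inter> Vn k)"
    using VS.span_scale[of "?P v" _ "inverse (of_nat (card H))"] by simp
qed

subsection \<open>Functions on the group spanned by matrix coefficients\<close>

text \<open>This is R_W. Its members are total functions on maps, but only their values on G are
  constrained, hence the conditional equations.\<close>

inductive_set orbit_functions :: "'v set \<Rightarrow> (('v \<Rightarrow> 'v) \<Rightarrow> 'v) set" for W where
  orbit: "x \<in> mode_algebra \<Longrightarrow> w \<in> W \<Longrightarrow> (\<And>g. g \<in> G \<Longrightarrow> \<Phi> g = x (g w)) \<Longrightarrow> \<Phi> \<in> orbit_functions W"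
| add: "\<Phi> \<in> orbit_functions W \<Longrightarrow> \<Psi> \<in> orbit_functions W \<Longrightarrow>
    (\<And>g. g \<in> G \<Longrightarrow> \<Theta> g = \<Phi> g + \<Psi> g) \<Longrightarrow> \<Theta> \<in> orbit_functions W"

lemma orbit_functions_cong:
  "\<Phi> \<in> orbit_functions W \<Longrightarrow> (\<And>g. g \<in> G \<Longrightarrow> \<Psi> g = \<Phi> g) \<Longrightarrow> \<Psi> \<in> orbit_functions W"
proof (induction arbitrary: \<Psi> rule: orbit_functions.induct)
  case (orbit x w \<Phi>)
  then show ?case by (intro orbit_functions.orbit[OF orbit(1,2)]) auto
next
  case (add \<Phi> \<Phi>' \<Theta>)
  then show ?case by (intro orbit_functions.add[OF add.hyps(1,2)]) auto
qed

lemma orbit_functions_mode_algebra: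
  assumes "\<Phi> \<in> orbit_functions W" "x \<in> mode_algebra"
  shows "(\<lambda>g. x (\<Phi> g)) \<in> orbit_functions W"
  using assms(1)
proof (induction rule: orbit_functions.induct)
  case (orbit y w \<Phi>)
  then show ?case
    by (intro orbit_functions.orbit[OF mode_algebra.comp[OF assms(2) orbit(1)]]) auto
next
  case (add \<Phi> \<Psi> \<Theta>)
  interpret x: Vector_Spaces.linear sc sc x by (rule mode_algebra_linear) fact
  show ?case by (rule orbit_functions.add[OF add.IH]) (simp add: add x.add)
qed

lemma orbit_functions_scale:
  "\<Phi> \<in> orbit_functions W \<Longrightarrow> (\<lambda>g. sc c (\<Phi> g)) \<in> orbit_functions W"
  by (rule orbit_functions_mode_algebra[OF _ scale_mode_algebra])

lemma orbit_functions_zero: "w \<in> W \<Longrightarrow> (\<lambda>g. 0) \<in> orbit_functions W"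
  by (rule orbit_functions.orbit[OF scale_mode_algebra[of 0]]) auto

lemma orbit_functions_sum:
  "w \<in> W \<Longrightarrow> (\<And>i. i \<in> I \<Longrightarrow> \<Phi> i \<in> orbit_functions W)
    \<Longrightarrow> (\<lambda>g. \<Sum>i\<in>I. \<Phi> i g) \<in> orbit_functions W"
  by (induction I rule: infinite_finite_induct)
    (auto intro: orbit_functions_zero orbit_functions.add)

text \<open>Weak commutativity moves $(gw)_m$ past $u_n$, again by descending induction on the index of the
  mode that acts first.\<close>

lemma orbit_functions_twisted_mode_mode:
  assumes W: "\<And>u v n. u \<in> W \<Longrightarrow> v \<in> W \<Longrightarrow> Y u n v \<in> W" and w: "w \<in> W" "w' \<in> W"
  shows "(\<lambda>g. Y (g w) m (Y u n (g w'))) \<in> orbit_functions W"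
proof -
  obtain K0 where K0: "\<And>n g. n \<ge> K0 \<Longrightarrow> g \<in> G \<Longrightarrow> Y u n (g w) = 0"
    using truncation_finite[of "(\<lambda>g. (u, g w)) ` G"] finite_G by auto
  obtain N where N: "\<And>n g. n \<ge> N \<Longrightarrow> g \<in> G \<Longrightarrow> Y u n (g w') = 0"
    using truncation_finite[of "(\<lambda>g. (u, g w')) ` G"] finite_G by auto
  \<comment> \<open>As an upper index of binomials the natural number \<open>K\<close> makes both
    sums on the right of the Jacobi identity stop after K + 1 terms; finiteness of G gives one bound
    for all g.\<close>
  define K where "K = nat K0"
  have K: "Y u (int K + i) (g w) = 0" if "g \<in> G" "i \<ge> 0" for g i
    using K0[OF _ that(1)] that(2) by (simp add: K_def)
  define e :: complex where "e = (if even K then 1 else -1)"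
  define c :: "nat \<Rightarrow> complex" where "c i = (-1) ^ i * (of_int (int K) gchoose i)" for i
  have c0: "c i = 0" if "i \<ge> Suc K" for i
    using that by (simp add: c_def binomial_gbinomial[symmetric])
  have ee: "e * e = 1" by (simp add: e_def)
  show ?thesis
  proof (induction "nat (N - n)" arbitrary: m n rule: less_induct)
    case less
    show ?case
    proof (cases "n \<ge> N")
      case True
      then show ?thesis
        by (intro orbit_functions_cong[OF orbit_functions_zero[OF w(1)]]) (simp add: N)
    next
      case False
      let ?S = "\<lambda>g. \<Sum>i<Suc K. sc (e * c i) (Y u (n + K - int i) (Y (g w) (m - K + int i) (g w')))"
      let ?R = "\<lambda>g. \<Sum>i<K. sc (- c (Suc i)) (Y (g w) (m - 1 - int i) (Y u (n + 1 + int i) (g w')))"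
      have eq: "Y (g w) m (Y u n (g w')) = ?S g + ?R g" if g: "g \<in> G" for g
      proof -
        let ?T = "\<Sum>i<Suc K. sc (e * c i) (Y (g w) (m - int i) (Y u (n + int i) (g w')))"
        \<comment> \<open>The Jacobi identity with p = n, q = m - K, r = K, whose left side vanishes
          by the choice of \<open>K\<close>.\<close>
        have "0 = fsum (\<lambda>i. sc ((of_int n :: complex) gchoose (nat i)) (Y (Y u (int K + i) (g w)) (n + (m - K) - i) (g w')))"
          by (simp add: fsum_eq_0 K g)
        also have "\<dots> = (\<Sum>i<Suc K. sc (c i) (Y u (n + K - int i) (Y (g w) (m - K + int i) (g w')))) - ?T"
          unfolding jacobi
          by (subst (1 2) fsum_eq_sum[of "Suc K"])
            (use c0 in \<open>auto simp: c_def e_def mult.assoc\<close>)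
        finally have "?T = (\<Sum>i<Suc K. sc (c i) (Y u (n + K - int i) (Y (g w) (m - K + int i) (g w'))))"
          by simp
        then have "sc e ?T = ?S g" by (simp only: VS.scale_sum_right VS.scale_scale)
        moreover have "sc e ?T = (\<Sum>i<Suc K. sc (c i) (Y (g w) (m - int i) (Y u (n + int i) (g w'))))"
          using ee by (simp only: VS.scale_sum_right VS.scale_scale mult.assoc[symmetric]) simp
        moreover have "\<dots> = Y (g w) m (Y u n (g w')) - ?R g"
          by (subst sum.lessThan_Suc_shift) (simp add: c_def sum_negf algebra_simps)
        ultimately show ?thesis by simp
      qed
      \<comment> \<open>Since g is an automorphism, (g w)_k (g w') = g (w_k w') with w_k w' in
        W.\<close>
      have S: "?S \<in> orbit_functions W"
        by (intro orbit_functions_sum[OF w(1)] orbit_functions_scale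
            orbit_functions.orbit[OF mode_algebra.mode W[OF w]]) (simp add: G_mode)
      have R: "?R \<in> orbit_functions W"
        by (intro orbit_functions_sum[OF w(1)] orbit_functions_scale less) (use False in auto)
      show ?thesis by (rule orbit_functions.add[OF S R eq])
    qed
  qed
qed

text \<open>The orbit of w' is finite, so on it x may be replaced by a sum of modes.\<close>

lemma orbit_functions_twisted_mode:
  assumes W: "\<And>u v n. u \<in> W \<Longrightarrow> v \<in> W \<Longrightarrow> Y u n v \<in> W" and w: "w \<in> W"
    and "\<Phi> \<in> orbit_functions W"
  shows "(\<lambda>g. Y (g w) m (\<Phi> g)) \<in> orbit_functions W"
  using assms(3)
proof (induction rule: orbit_functions.induct)
  case (orbit x w' \<Phi>)
  obtain s where s: "s \<in> modes" "\<And>g. g \<in> G \<Longrightarrow> x (g w') = s (g w')"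
    using mode_algebra_locally_modes[OF orbit(1), of "(\<lambda>g. g w') ` G"] finite_G
    unfolding locally_modes_def by blast
  from s(1) have "(\<lambda>g. Y (g w) m (s (g w'))) \<in> orbit_functions W"
    by (induction rule: modes.induct)
      (auto intro: orbit_functions.add orbit_functions_twisted_mode_mode[OF W w orbit(2)])
  then show ?case by (rule orbit_functions_cong) (simp add: orbit s)
next
  case (add \<Phi> \<Psi> \<Theta>)
  show ?case by (rule orbit_functions.add[OF add.IH]) (simp add: add)
qed

text \<open>Creation does the work: x ((g w)_(-1) (e(g) vac)) = e(g) x (g w).\<close>

lemma orbit_functions_mult:
  assumes W: "\<And>u v n. u \<in> W \<Longrightarrow> v \<in> W \<Longrightarrow> Y u n v \<in> W"
    and e: "(\<lambda>g. sc (e g) vac) \<in> orbit_functions W" and \<Phi>: "\<Phi> \<in> orbit_functions W"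
  shows "(\<lambda>g. sc (e g) (\<Phi> g)) \<in> orbit_functions W"
  using \<Phi>
proof (induction rule: orbit_functions.induct)
  case (orbit x w \<Phi>)
  interpret x: Vector_Spaces.linear sc sc x by (rule mode_algebra_linear) fact
  have "(\<lambda>g. x (Y (g w) (-1) (sc (e g) vac))) \<in> orbit_functions W"
    by (intro orbit_functions_mode_algebra[OF _ orbit(1)] orbit_functions_twisted_mode[OF W orbit(2) e])
  then show ?case by (rule orbit_functions_cong) (simp add: orbit creation x.scale)
next
  case (add \<Phi> \<Psi> \<Theta>)
  show ?case by (rule orbit_functions.add[OF add.IH]) (simp add: add VS.scale_right_distrib)
qed

lemma orbit_functions_const:
  assumes "vac \<in> W"
  shows "(\<lambda>g. sc c vac) \<in> orbit_functions W"
  by (rule orbit_functions.orbit[OF scale_mode_algebra[of c] assms]) (simp add: G_vac)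

text \<open>As in Lagrange interpolation, e is a product with one factor for each d in D. If d moves
  w, a functional that is 1 at w - d w gives scalars c with c(id) - c(d) = 1, and the factor is c -
  c(d).\<close>

lemma orbit_functions_separate:
  assumes W: "\<And>u v n. u \<in> W \<Longrightarrow> v \<in> W \<Longrightarrow> Y u n v \<in> W" and vac: "vac \<in> W"
    and "finite D" "\<And>d. d \<in> D \<Longrightarrow> d \<in> G \<and> (\<exists>w\<in>W. d w \<noteq> w)"
  shows "\<exists>e. (\<lambda>g. sc (e g) vac) \<in> orbit_functions W \<and> e id = 1 \<and> (\<forall>d\<in>D. e d = 0)"
  using assms(3,4)
proof (induction D rule: finite_induct)
  case empty
  show ?case using orbit_functions_const[OF vac, of 1] by (intro exI[of _ "\<lambda>g. 1"]) auto
next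
  case (insert d D)
  obtain e where e: "(\<lambda>g. sc (e g) vac) \<in> orbit_functions W" "e id = 1" "\<forall>d\<in>D. e d = 0"
    using insert by blast
  obtain w where w: "w \<in> W" "w - d w \<noteq> 0" and d: "d \<in> G" using insert.prems[of d] by auto
  obtain x where x: "x \<in> mode_algebra" "x (w - d w) = vac" "\<forall>u\<in>(\<lambda>g. g w) ` G. \<exists>c. x u = sc c vac"
    using mode_algebra_functional[OF _ w(2), of "(\<lambda>g. g w) ` G"] finite_G by auto
  then obtain c where c: "\<And>g. g \<in> G \<Longrightarrow> x (g w) = sc (c g) vac"
    by (simp add: image_iff) metis
  interpret x: Vector_Spaces.linear sc sc x by (rule mode_algebra_linear) fact
  have "vac \<noteq> 0" using creation[of "w - d w"] w by auto
  moreover have "sc (c id - c d) vac = sc 1 vac"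
    using x(2) c[OF d] c[OF id_in_G] by (simp add: x.diff VS.scale_left_diff_distrib)
  ultimately have c1: "c id - c d = 1" by (metis VS.scale_cancel_right)
  define e' where "e' g = c g - c d" for g
  have "(\<lambda>g. x (g w) + sc (- c d) vac) \<in> orbit_functions W"
    by (rule orbit_functions.add[OF orbit_functions.orbit[OF x(1) w(1)] orbit_functions_const[OF vac, of "- c d"]]) auto
  then have e': "(\<lambda>g. sc (e' g) vac) \<in> orbit_functions W"
    by (rule orbit_functions_cong) (simp add: c e'_def VS.scale_left_diff_distrib)
  have "(\<lambda>g. sc (e' g * e g) vac) \<in> orbit_functions W"
    using orbit_functions_mult[OF W e' e(1)] by simp
  moreover have "e' id * e id = 1" "\<forall>d\<in>insert d D. e' d * e d = 0"
    using e c1 by (auto simp: e'_def)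
  ultimately show ?case by (intro exI[of _ "\<lambda>g. e' g * e g"] conjI)
qed

text \<open>Members of R_W are constant on cosets of the pointwise stabilizer of W; this carries the
  value at \<open>id\<close> to the whole stabilizer.\<close>

lemma orbit_functions_invariant:
  assumes "\<Phi> \<in> orbit_functions W" "g \<in> G" "h \<in> G" "\<And>w. w \<in> W \<Longrightarrow> h w = w"
  shows "\<Phi> (g \<circ> h) = \<Phi> g"
  using assms(1)
proof (induction rule: orbit_functions.induct)
  case (orbit x w \<Phi>)
  show ?case
    unfolding orbit(3)[OF assms(2)] orbit(3)[OF comp_in_G[OF assms(2,3)]]
    using assms(4)[OF orbit(2)] by simp
next
  case (add \<Phi> \<Psi> \<Theta>)
  then show ?case
    by (simp only: add.hyps(3)[OF assms(2)] add.hyps(3)[OF comp_in_G[OF assms(2,3)]])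
qed

lemma orbit_functions_average:
  assumes W: "\<And>u v n. u \<in> W \<Longrightarrow> v \<in> W \<Longrightarrow> Y u n v \<in> W"
    and sub: "VS.subspace W" and GW: "fixed_points G \<subseteq> W"
    and "\<Phi> \<in> orbit_functions W"
  shows "(\<Sum>g\<in>G. inv g (\<Phi> g)) \<in> W"
  using assms(4)
proof (induction rule: orbit_functions.induct)
  case (orbit x w \<Phi>)
  obtain s where s: "s \<in> modes" "\<And>g. g \<in> G \<Longrightarrow> x (g w) = s (g w)"
    using mode_algebra_locally_modes[OF orbit(1), of "(\<lambda>g. g w) ` G"] finite_G
    unfolding locally_modes_def by blast
  from s(1) have "(\<Sum>g\<in>G. inv g (s (g w))) \<in> W"
  proof (induction rule: modes.induct)
    case (mode u n)
    \<comment> \<open>Conjugating u_n by the inverse of g gives the mode of the translated vector,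
      and the translates of u add up to a vector of V^G.\<close>
    have "(\<Sum>g\<in>G. inv g (Y u n (g w))) = Y (\<Sum>g\<in>G. inv g u) n w"
      by (simp add: mode_sum_left G_mode[OF inv_in_G] G_inv_cancel)
    also have "(\<Sum>g\<in>G. inv g u) = (\<Sum>g\<in>G. g u)"
      by (rule sum.reindex_bij_witness[of _ inv inv]) (auto simp: inv_in_G bij_G inv_inv_eq)
    finally show ?case
      using sum_orbit_fixed[of G u] group GW orbit(2) W by (auto simp: map_subgroup_def)
  next
    case (add s t)
    then show ?case
      using VS.subspace_add[OF sub] by (simp add: G_add[OF inv_in_G] sum.distrib)
  qed
  then show ?case by (simp add: orbit s)
next
  case (add \<Phi> \<Psi> \<Theta>)
  then show ?case
    using VS.subspace_add[OF sub] by (simp add: G_add[OF inv_in_G] sum.distrib)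
qed

subsection \<open>The correspondence\<close>

lemma map_subgroup_pointwise_stabilizer: "map_subgroup {g\<in>G. \<forall>w\<in>W. g w = w} G"
  unfolding map_subgroup_def map_group_def
proof (intro conjI ballI)
  fix g assume g: "g \<in> {g\<in>G. \<forall>w\<in>W. g w = w}"
  show "bij g" using g bij_G by blast
  have "inv g w = w" if "w \<in> W" for w
    using G_inv_cancel(1)[of g w] g that by simp
  then show "inv g \<in> {g\<in>G. \<forall>w\<in>W. g w = w}" using g inv_in_G by simp
qed (use id_in_G comp_in_G in auto)

lemma fixed_points_pointwise_stabilizer:
  assumes W: "sub_VOA sc Y vac om Vn W" and GW: "fixed_points G \<subseteq> W"
  shows "fixed_points {g\<in>G. \<forall>w\<in>W. g w = w} = W"
proof
  let ?H = "{g\<in>G. \<forall>w\<in>W. g w = w}"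
  have cl: "Y u n v \<in> W" if "u \<in> W" "v \<in> W" for u v n using W that by (auto simp: sub_VOA_def)
  have sub: "VS.subspace W" and vac: "vac \<in> W" using W by (auto simp: sub_VOA_def)
  show "W \<subseteq> fixed_points ?H" by (auto simp: fixed_points_def)
  show "fixed_points ?H \<subseteq> W"
  proof
    fix b assume b: "b \<in> fixed_points ?H"
    have "\<exists>e. (\<lambda>g. sc (e g) vac) \<in> orbit_functions W \<and> e id = 1 \<and> (\<forall>d\<in>G - ?H. e d = 0)"
      by (rule orbit_functions_separate[OF cl vac]) (use finite_G in auto)
    then obtain e where e: "(\<lambda>g. sc (e g) vac) \<in> orbit_functions W" "e id = 1" "\<And>d. d \<in> G - ?H \<Longrightarrow> e d = 0"
      by blast
    \<comment> \<open>Applying b_(-1) to the values replaces \<open>vac\<close> by b.\<close>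
    have eb: "(\<lambda>g. sc (e g) b) \<in> orbit_functions W"
      using orbit_functions_mode_algebra[OF e(1) mode_algebra.mode[of b "-1"]] by (simp add: creation)
    have "sc (e h) b = b" if "h \<in> ?H" for h
      using orbit_functions_invariant[OF eb id_in_G, of h] that e(2) by simp
    moreover have "inv h b = b" if "h \<in> ?H" for h
    proof -
      have "h b = b" using b that by (simp add: fixed_points_def)
      then show ?thesis using G_inv_cancel(1)[of h b] that by simp
    qed
    moreover have "inv g 0 = 0" if "g \<in> G" for g
      using G_scale[OF inv_in_G[OF that], of 0 0] by simp
    ultimately have "inv g (sc (e g) b) = (if g \<in> ?H then b else 0)" if "g \<in> G" for g
      using that e(3)[of g] by (cases "g \<in> ?H") auto
    then have "(\<Sum>g\<in>G. inv g (sc (e g) b)) = (\<Sum>g\<in>G. if g \<in> ?H then b else 0)"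
      by (rule sum.cong[OF refl])
    also have "\<dots> = (\<Sum>g\<in>?H. b)"
      by (rule sum.mono_neutral_cong_right) (use finite_G in auto)
    also have "\<dots> = sc (of_nat (card ?H)) b" by (simp add: VS.sum_constant_scale)
    finally have "sc (of_nat (card ?H)) b \<in> W"
      using orbit_functions_average[OF cl sub GW eb] by simp
    moreover have "id \<in> ?H" using id_in_G by simp
    then have "of_nat (card ?H) \<noteq> (0::complex)" using finite_G by auto
    ultimately show "b \<in> W"
      using VS.subspace_scale[OF sub, of _ "inverse (of_nat (card ?H))"] by fastforce
  qed
qed

lemma pointwise_stabilizer_fixed_points:
  assumes HG: "map_subgroup H G"
  shows "{g\<in>G. \<forall>w\<in>fixed_points H. g w = w} = H"
proof
  have H: "H \<subseteq> G" "map_group H" "finite H"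
    using HG finite_G by (auto simp: map_subgroup_def intro: finite_subset)
  show "H \<subseteq> {g\<in>G. \<forall>w\<in>fixed_points H. g w = w}" using H by (auto simp: fixed_points_def)
  show "{g\<in>G. \<forall>w\<in>fixed_points H. g w = w} \<subseteq> H"
  proof
    fix g assume "g \<in> {g\<in>G. \<forall>w\<in>fixed_points H. g w = w}"
    then have g: "g \<in> G" "\<And>w. w \<in> fixed_points H \<Longrightarrow> g w = w" by auto
    \<comment> \<open>The vector \<Sum> h v over H is H-invariant, hence fixed by g; this passes to
      all matrix coefficients.\<close>
    have shift: "(\<Sum>h\<in>H. \<Phi> (g \<circ> h)) = (\<Sum>h\<in>H. \<Phi> h)" if "\<Phi> \<in> orbit_functions UNIV" for \<Phi>
      using that
    proof (induction rule: orbit_functions.induct)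
      case (orbit x v \<Phi>)
      interpret x: Vector_Spaces.linear sc sc x by (rule mode_algebra_linear) fact
      have "(\<Sum>h\<in>H. \<Phi> (g \<circ> h)) = (\<Sum>h\<in>H. x (g (h v)))"
        using H g comp_in_G by (intro sum.cong) (auto simp: orbit)
      also have "\<dots> = x (g (\<Sum>h\<in>H. h v))" by (simp add: x.sum G_sum[OF g(1)])
      also have "\<dots> = (\<Sum>h\<in>H. x (h v))" by (simp add: g(2) sum_orbit_fixed[OF HG] x.sum)
      also have "\<dots> = (\<Sum>h\<in>H. \<Phi> h)" using H by (intro sum.cong) (auto simp: orbit)
      finally show ?case .
    next
      case (add \<Phi> \<Psi> \<Theta>)
      have "(\<Sum>h\<in>H. \<Theta> (g \<circ> h)) = (\<Sum>h\<in>H. \<Phi> (g \<circ> h) + \<Psi> (g \<circ> h))"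
        using H g comp_in_G by (intro sum.cong) (auto simp: add)
      also have "\<dots> = (\<Sum>h\<in>H. \<Phi> h + \<Psi> h)" by (simp add: sum.distrib add.IH)
      also have "\<dots> = (\<Sum>h\<in>H. \<Theta> h)" using H by (intro sum.cong) (auto simp: add)
      finally show ?case .
    qed
    show "g \<in> H"
    proof (rule ccontr)
      assume "g \<notin> H"
      then have "g \<noteq> id" using H by (auto simp: map_group_def)
      then obtain v where "g v \<noteq> v" by (auto simp: fun_eq_iff)
      then have vac0: "vac \<noteq> 0" using creation[of "g v - v"] by auto
      \<comment> \<open>For W = V every element of G other than \<open>id\<close> moves some vector,
        so e can be the indicator of \<open>id\<close> on G.\<close>
      have "\<exists>e. (\<lambda>g. sc (e g) vac) \<in> orbit_functions UNIV \<and> e id = 1 \<and> (\<forall>d\<in>G - {id}. e d = 0)"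
        by (rule orbit_functions_separate) (use finite_G in \<open>auto simp: fun_eq_iff\<close>)
      then obtain e where e: "(\<lambda>g. sc (e g) vac) \<in> orbit_functions UNIV" "e id = 1"
        "\<And>d. d \<in> G \<Longrightarrow> d \<noteq> id \<Longrightarrow> e d = 0"
        by blast
      have "g \<circ> h \<noteq> id" if "h \<in> H" for h
      proof
        assume "g \<circ> h = id"
        moreover have "h \<in> G" using H(1) that by blast
        ultimately have "g v = inv h v" for v
          using G_inv_cancel(2)[of h v] by (metis comp_apply id_apply)
        then have "g = inv h" by (rule ext)
        then show False using \<open>g \<notin> H\<close> H(2) that by (simp add: map_group_def)
      qed
      \<comment> \<open>The coset g H misses \<open>id\<close> while H contains it, so the two sides
        of \<open>shift\<close> would be 0 and \<open>vac\<close>.\<close>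
      then have "(\<Sum>h\<in>H. sc (e (g \<circ> h)) vac) = 0"
        using H g comp_in_G e(3) by (intro sum.neutral) auto
      moreover have "(\<Sum>h\<in>H. sc (e h) vac) = (\<Sum>h\<in>{id}. sc (e h) vac)"
        by (rule sum.mono_neutral_right) (use H e(3) in \<open>auto simp: map_group_def\<close>)
      ultimately show False using shift[OF e(1)] e(2) vac0 by simp
    qed
  qed
qed

theorem galois_correspondence:
  "bij_betw fixed_points {H. map_subgroup H G}
     {W. sub_VOA sc Y vac om Vn W \<and> fixed_points G \<subseteq> W}"
\<comment> \<open>The inverse map sends W to its pointwise stabilizer in G.\<close>
proof (rule bij_betw_byWitness[where f' = "\<lambda>W. {g\<in>G. \<forall>w\<in>W. g w = w}"])
  show "fixed_points ` {H. map_subgroup H G} \<subseteq> {W. sub_VOA sc Y vac om Vn W \<and> fixed_points G \<subseteq> W}"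
    using sub_VOA_fixed_points by (auto simp: map_subgroup_def fixed_points_def)
qed (use map_subgroup_pointwise_stabilizer fixed_points_pointwise_stabilizer
    pointwise_stabilizer_fixed_points in auto)

end

theorem theorem1:
  fixes sc :: "complex \<Rightarrow> 'v::ab_group_add \<Rightarrow> 'v"
    and Y :: "'v \<Rightarrow> int \<Rightarrow> 'v \<Rightarrow> 'v"
    and vac om :: 'v
    and Vn :: "int \<Rightarrow> 'v set"
    and G :: "('v \<Rightarrow> 'v) set"
  assumes "is_VOA sc Y vac om Vn"
    and "simple_VOA sc Y"
    and "map_group G" and "finite G"
    and "\<forall>g\<in>G. VOA_aut sc Y vac om g"
    and "abelian_maps G \<or> dihedral_maps G"
  shows "bij_betw fixed_points {H. map_subgroup H G}
           {W. sub_VOA sc Y vac om Vn W \<and> fixed_points G \<subseteq> W}"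
proof -
  interpret voa_galois sc Y vac om Vn G
    using assms by unfold_locales
  show ?thesis by (rule galois_correspondence)
qed

end
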